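(* Let $\sigma$ be a permutation of $\mathbb{N}_0$ defining a piecewise linear rearrangement. Then $\#\tilde A^\sigma_n\le 6^n$ for all $n=0,1,2,\ldots$. Consequently, for every $p\in[1,\infty]$ with $p\ne2$, the systems $(e_k)_{k\ge0}$ and $(w_{\sigma(k)})_{k\ge0}$ are not equivalent in $L_p$. In particular, for every $p\in[1,\infty]$ with $p\neq2$, the Walsh-Kaczmarz system is not equivalent to the trigonometric system $(e_k)_{k\ge 0}$ in $L_p$.
   Context: $\mathbb{N}_0=\{0,1,2,\ldots\}$ and $[m]=\{0,1,\ldots,m-1\}$; $m+[m']=\{m,m+1,\ldots,m+m'-1\}$; $\#A$ is the cardinality of $A$. For $n\in\mathbb{N}_0$ with binary expansion $n=\sum_{i\ge0} n_i2^i$, $n_i\in\{0,1\}$, the dyadic sum is $m\oplus n=\sum_{i\ge 0}|m_i-n_i|2^i$ (bitwise XOR). On $[0,1]$, $e_n(t)=\exp(2\pi i n t)$; $r_0,r_1,\ldots$ are the Rademacher functions ($r_i(t)=\operatorname{sign}\sin(2^{i+1}\pi t)$), and $w_n=\prod_{i\ge 0} r_i^{n_i}$ is the $n$-th Walsh function. Two systems $(a_k)_{k\ge0}$, $(b_k)_{k\ge0}$ in $L_p[0,1]$ are equivalent in $L_p$ ($1\le p\le\infty$) if there is $c>0$ such that $\frac1c\|\sum_k\xi_k a_k\|_p\le\|\sum_k\xi_k b_k\|_p\le c\|\sum_k\xi_k a_k\|_p$ for all complex sequences $(\xi_k)_{k\ge0}$ with finitely many nonzero terms; $\|\cdot\|_p$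 is the norm of $L_p[0,1]$. A permutation $\sigma$ of $\mathbb{N}_0$ defines a piecewise linear rearrangement if $\sigma(0)=0$ and, for every $k\ge0$, there is a bijection $\sigma_k:[2^k]\to[2^k]$ with $\sigma_k(a\oplus b)=\sigma_k(a)\oplus\sigma_k(b)$ for all $a,b\in[2^k]$, such that $\sigma(2^k+m)=2^k+\sigma_k(m)$ for $0\le m\le 2^k-1$. The Walsh-Kaczmarz system is $(w_{\sigma(k)})_{k\ge0}$ for the permutation with $\sigma(0)=0$ and $\sigma(2^k+\sum_{i=0}^{k-1}x_i2^i)=2^k+\sum_{i=0}^{k-1}x_{k-1-i}2^i$ for $k\ge0$, $x_0,\ldots,x_{k-1}\in\{0,1\}$. $\tilde A^\sigma_n=\{(k,l,m)\in(2^n+[2^n])^3 : k+l-m\in 2^n+[2^n],\ \sigma(k)\oplus\sigma(l)\oplus\sigma(m)=\sigma(k+l-m)\}$. *)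

theory Defs
  imports "HOL-Probability.Essential_Supremum" "HOL-Library.Discrete_Functions"
begin

unbundle bit_operations_syntax

definition trig :: "nat \<Rightarrow> real \<Rightarrow> complex" where
  "trig n t = exp (2 * of_real pi * \<i> * of_nat n * of_real t)"

definition rademacher :: "nat \<Rightarrow> real \<Rightarrow> real" where
  "rademacher i t = sgn (sin (2 ^ (i + 1) * pi * t))"

text \<open>A natural number has finitely many nonzero binary digits, so this is a finite product.\<close>

definition walsh :: "nat \<Rightarrow> real \<Rightarrow> complex" where
  "walsh n t = (\<Prod>i | bit n i. of_real (rademacher i t))"

text \<open>\<^term>\<open>Lp_norm\<close> is meaningful only for functions in \<^term>\<open>Lp_space\<close>: the Bochner
  integral of a non-integrable function and the real value of an infinite essential supremum
  are 0. The lemmas \<open>trig_sum_in_Lp\<close> and \<open>walsh_sum_in_Lp\<close> below show that the functions to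
  which it is applied do belong to that space.\<close>

definition Lp_space :: "ereal \<Rightarrow> (real \<Rightarrow> complex) set" where
  "Lp_space p = {f \<in> borel_measurable (lebesgue_on {0..1}).
     if p = \<infinity> then esssup (lebesgue_on {0..1}) (\<lambda>t. ereal (norm (f t))) < \<infinity>
     else integrable (lebesgue_on {0..1}) (\<lambda>t. norm (f t) powr real_of_ereal p)}"

definition Lp_norm :: "ereal \<Rightarrow> (real \<Rightarrow> complex) \<Rightarrow> real" where
  "Lp_norm p f =
     (if p = \<infinity> then real_of_ereal (esssup (lebesgue_on {0..1}) (\<lambda>t. ereal (norm (f t))))
      else (\<integral>t. norm (f t) powr real_of_ereal p \<partial>lebesgue_on {0..1}) powr (1 / real_of_ereal p))"

definition equivalent_in_Lp ::
  "ereal \<Rightarrow> (nat \<Rightarrow> real \<Rightarrow> complex) \<Rightarrow> (nat \<Rightarrow> real \<Rightarrow> complex) \<Rightarrow> bool" where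
  "equivalent_in_Lp p a b \<longleftrightarrow>
     (\<exists>c>0. \<forall>\<xi> :: nat \<Rightarrow> complex. finite {k. \<xi> k \<noteq> 0} \<longrightarrow>
        1 / c * Lp_norm p (\<lambda>t. \<Sum>k | \<xi> k \<noteq> 0. \<xi> k * a k t)
          \<le> Lp_norm p (\<lambda>t. \<Sum>k | \<xi> k \<noteq> 0. \<xi> k * b k t) \<and>
        Lp_norm p (\<lambda>t. \<Sum>k | \<xi> k \<noteq> 0. \<xi> k * b k t)
          \<le> c * Lp_norm p (\<lambda>t. \<Sum>k | \<xi> k \<noteq> 0. \<xi> k * a k t))"

definition piecewise_linear_rearrangement :: "(nat \<Rightarrow> nat) \<Rightarrow> bool" where
  "piecewise_linear_rearrangement \<sigma> \<longleftrightarrow>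
     bij \<sigma> \<and> \<sigma> 0 = 0 \<and>
     (\<forall>k. \<exists>\<tau>. bij_betw \<tau> {..<2 ^ k} {..<2 ^ k} \<and>
        (\<forall>a<2 ^ k. \<forall>b<2 ^ k. \<tau> (a XOR b) = \<tau> a XOR \<tau> b) \<and>
        (\<forall>m<2 ^ k. \<sigma> (2 ^ k + m) = 2 ^ k + \<tau> m))"

text \<open>The digits below the leading binary digit are reversed; see \<open>kaczmarz_digits\<close>.\<close>

definition kaczmarz :: "nat \<Rightarrow> nat" where
  "kaczmarz n =
     (if n = 0 then 0
      else let k = floor_log n in 2 ^ k + (\<Sum>i<k. of_bool (bit n (k - 1 - i)) * 2 ^ i))"

text \<open>For \<open>k\<close>, \<open>l\<close>, \<open>m\<close> in the block \<open>{2^n..<2^(n+1)}\<close> we have \<open>m < k + l\<close>, so the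
  subtraction of natural numbers is not truncated.\<close>

definition A_tilde :: "(nat \<Rightarrow> nat) \<Rightarrow> nat \<Rightarrow> (nat \<times> nat \<times> nat) set" where
  "A_tilde \<sigma> n = {(k, l, m).
     k \<in> {2 ^ n..<2 ^ n + 2 ^ n} \<and> l \<in> {2 ^ n..<2 ^ n + 2 ^ n} \<and> m \<in> {2 ^ n..<2 ^ n + 2 ^ n} \<and>
     k + l - m \<in> {2 ^ n..<2 ^ n + 2 ^ n} \<and>
     \<sigma> k XOR \<sigma> l XOR \<sigma> m = \<sigma> (k + l - m)}"

lemma finite_A_tilde: "finite (A_tilde \<sigma> n)"
  by (rule finite_subset[of _
        "{2 ^ n..<2 ^ n + 2 ^ n} \<times> {2 ^ n..<2 ^ n + 2 ^ n} \<times> {2 ^ n..<2 ^ n + 2 ^ n}"])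
    (auto simp: A_tilde_def)

lemma finite_bits_nat: "finite {i. bit (n :: nat) i}"
proof (rule finite_subset)
  show "{i. bit n i} \<subseteq> {..<n}"
  proof
    fix i assume "i \<in> {i. bit n i}"
    then have "2 ^ i \<le> n"
      by (metis bit_iff_odd div_less even_zero mem_Collect_eq not_le)
    moreover have "i < 2 ^ i" by (rule less_exp)
    ultimately have "i < n" by (rule order_less_le_trans[rotated])
    then show "i \<in> {..<n}" by simp
  qed
qed simp

lemma walsh_0: "walsh 0 t = 1"
  by (simp add: walsh_def)

lemma bit_sum_digits:
  fixes x :: "nat \<Rightarrow> bool"
  shows "(\<Sum>i<k. of_bool (x i) * 2 ^ i :: nat) < 2 ^ k
    \<and> (\<forall>j. bit (\<Sum>i<k. of_bool (x i) * 2 ^ i :: nat) j \<longleftrightarrow> j < k \<and> x j)"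
proof -
  have "(\<Sum>i<k. of_bool (x i) * 2 ^ i :: nat) = horner_sum of_bool 2 (map x [0..<k])"
    by (simp add: horner_sum_eq_sum atLeast0LessThan)
  then show ?thesis
    using horner_sum_of_bool_2_less[of "map x [0..<k]"]
    by (auto simp: bit_horner_sum_bit_iff)
qed

lemma kaczmarz_digits:
  assumes "\<And>i. i < k \<Longrightarrow> x i \<in> {0, 1}"
  shows "kaczmarz (2 ^ k + (\<Sum>i<k. x i * 2 ^ i)) = 2 ^ k + (\<Sum>i<k. x (k - 1 - i) * 2 ^ i)"
proof -
  define s where "s = (\<Sum>i<k. of_bool (x i = 1) * 2 ^ i :: nat)"
  have s: "(\<Sum>i<k. x i * 2 ^ i) = s"
    unfolding s_def using assms by (intro sum.cong) auto
  have lt: "s < 2 ^ k" and bits: "bit s j \<longleftrightarrow> j < k \<and> x j = 1" for j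
    using bit_sum_digits[where k = k and x = "\<lambda>i. x i = 1"] by (auto simp: s_def)
  have fl: "floor_log (2 ^ k + s) = k"
    using lt by (intro floor_log_eqI) auto
  have "bit (2 ^ k + s) j \<longleftrightarrow> bit s j" if "j < k" for j
  proof -
    have "take_bit k (2 ^ k + s) = take_bit k s"
      by (simp add: take_bit_eq_mod)
    then show ?thesis using that by (metis bit_take_bit_iff)
  qed
  then have "of_bool (bit (2 ^ k + s) (k - 1 - i)) = x (k - 1 - i)" if "i < k" for i
    using that bits assms[of "k - 1 - i"] by auto
  then have "(\<Sum>i<k. of_bool (bit (2 ^ k + s) (k - 1 - i)) * 2 ^ i)
      = (\<Sum>i<k. x (k - 1 - i) * 2 ^ i)"
    by (intro sum.cong) auto
  then show ?thesis by (simp add: s kaczmarz_def fl Let_def)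
qed

lemma bounded_in_Lp:
  assumes f: "f \<in> borel_measurable borel" and bound: "\<And>t. norm (f t) \<le> C"
    and p: "1 \<le> p"
  shows "f \<in> Lp_space p"
proof -
  let ?M = "lebesgue_on {0..1::real}"
  have fM: "f \<in> borel_measurable ?M"
    using f by (intro measurable_restrict_space1 measurable_completion) simp
  have "esssup ?M (\<lambda>t. ereal (norm (f t))) < \<infinity>" if "p = \<infinity>"
  proof -
    have "esssup ?M (\<lambda>t. ereal (norm (f t))) \<le> ereal C"
      using fM bound by (intro esssup_I) auto
    also have "\<dots> < \<infinity>" by simp
    finally show ?thesis .
  qed
  moreover have "integrable ?M (\<lambda>t. norm (f t) powr real_of_ereal p)" if "p \<noteq> \<infinity>"
  proof -
    interpret finite_measure ?M by (rule finite_measure_lebesgue_on) simp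
    have "0 \<le> real_of_ereal p" using p by (intro real_of_ereal_pos) (metis order_trans ereal_less_eq(5) zero_le_one one_ereal_def)
    then have "norm (f t) powr real_of_ereal p \<le> C powr real_of_ereal p" for t
      using bound by (intro powr_mono2) auto
    then show ?thesis
      using fM by (intro integrable_const_bound[of _ "C powr real_of_ereal p"]) auto
  qed
  ultimately show ?thesis using fM by (simp add: Lp_space_def)
qed

lemma sum_in_Lp:
  assumes "\<And>k. a k \<in> borel_measurable borel" and bound: "\<And>k t. norm (a k t) \<le> 1"
    and "1 \<le> p"
  shows "(\<lambda>t. \<Sum>k\<in>K. \<xi> k * a k t) \<in> Lp_space p"
proof (rule bounded_in_Lp)
  show "norm (\<Sum>k\<in>K. \<xi> k * a k t) \<le> (\<Sum>k\<in>K. norm (\<xi> k))" for t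
    using bound by (intro sum_norm_le) (simp add: norm_mult mult_left_le)
qed (use assms in measurable)

lemma trig_sum_in_Lp: "1 \<le> p \<Longrightarrow> (\<lambda>t. \<Sum>k\<in>K. \<xi> k * trig k t) \<in> Lp_space p"
proof (rule sum_in_Lp)
  show "trig k \<in> borel_measurable borel" for k
    unfolding trig_def[abs_def] by (intro borel_measurable_continuous_onI continuous_intros)
  show "norm (trig k t) \<le> 1" for k t
    by (simp add: trig_def norm_exp_eq_Re)
qed

lemma walsh_sum_in_Lp: "1 \<le> p \<Longrightarrow> (\<lambda>t. \<Sum>k\<in>K. \<xi> k * walsh (\<sigma> k) t) \<in> Lp_space p"
proof (rule sum_in_Lp)
  show "walsh (\<sigma> k) \<in> borel_measurable borel" for k
    unfolding walsh_def[abs_def] rademacher_def by measurable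
  show "norm (walsh (\<sigma> k) t) \<le> 1" for k t
    unfolding walsh_def prod_norm[symmetric]
    by (intro prod_le_1) (auto simp: rademacher_def sgn_if)
qed

end

theory Submission
  imports Defs
begin

text \<open>The argument compares the two systems on the block \<open>2^n \<le> k < 2^(n+1)\<close> with the random signs
\<open>\<chi> x (\<sigma> k)\<close>, where \<open>\<chi> x m = (- 1) ^ (number of common binary digits of x and m)\<close> and \<open>x\<close> ranges
over all numbers below \<open>2^(n+1)\<close>. Write \<open>F x\<close> and \<open>W x\<close> for the resulting trigonometric and
Walsh polynomials.

On the Walsh side the signs achieve nothing: for almost every \<open>t\<close> the values \<open>w_m(t)\<close> with
\<open>m < 2^(n+1)\<close> are themselves \<open>\<chi> y m\<close> for some \<open>y\<close>, so averaging over \<open>x\<close> merely translates by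
\<open>y\<close>, and \<open>W x\<close> is as concentrated as a Dirichlet kernel: of the \<open>2^(n+1)\<close> values
\<open>\<bar>W x t\<bar>\<close> two are \<open>2^n\<close> and the others vanish (\<open>walsh_moment_eq\<close>).

On the trigonometric side the signs flatten the kernel. By orthogonality in both \<open>x\<close> and \<open>t\<close>,
the averaged fourth moment counts the quadruples with \<open>k + l = m + q\<close> and
\<open>\<sigma> k \<oplus> \<sigma> l = \<sigma> m \<oplus> \<sigma> q\<close>, that is, the set \<^const>\<open>A_tilde\<close>
(\<open>trig_moment_4_le_card_A_tilde\<close>). Since \<open>\<sigma>\<close> is affine on the block, the second equation is
\<open>k \<oplus> l = m \<oplus> q\<close>. Addition is exclusive or plus twice the carries, so then also
\<open>k AND l = m AND q\<close>: at every digit position the pairs of digits of \<open>(k, l)\<close> and of \<open>(m, q)\<close>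
agree up to order, which leaves 6 of the 8 patterns for \<open>(k, l, m)\<close>. Hence there are at most
\<open>6^n\<close> triples (\<open>card_A_tilde_le\<close>), whereas the Walsh side corresponds to \<open>8^n\<close>.

The second moments of both sides agree. For finite \<open>p \<noteq> 2\<close>, interpolation between powers
(above \<open>p = 4\<close>, the trivial bound \<open>\<bar>F x t\<bar> \<le> 2^n\<close>) therefore separates the \<open>p\<close>-th moments of
\<open>F\<close> and \<open>W\<close> by a factor that grows exponentially in \<open>n\<close>: those of \<open>W\<close> are larger for \<open>p > 2\<close>
and smaller for \<open>p < 2\<close>.
For \<open>p = \<infinity>\<close> the roles of the two variables are exchanged: with the coefficients
\<open>e_k(-u)\<close> the trigonometric polynomial attains \<open>2^n\<close>, while the values of the Walsh polynomial
are, up to conjugation, the numbers \<open>F x u\<close>; so \<open>max\<^sub>x \<bar>F x u\<bar>\<close> is at least a constant times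
\<open>2^n\<close> for every \<open>u\<close> in the open unit interval, against the bound on the fourth moment (\<open>not_equivalent_in_Linfinity\<close>).

Reversing digits is an involution that respects exclusive or, so the Walsh-Kaczmarz system is
a special case.\<close>

section \<open>Dyadic blocks and exclusive or\<close>

abbreviation dyadic_block :: "nat \<Rightarrow> nat set" where
  "dyadic_block n \<equiv> {2 ^ n..<2 ^ n + 2 ^ n}"

text \<open>Exclusive or adds without carrying; the positions where both digits are 1 are the carries.\<close>

lemma add_eq_xor_plus_double_and:
  fixes a b :: nat
  shows "a + b = (a XOR b) + 2 * (a AND b)"
proof (induction a arbitrary: b rule: less_induct)
  case (less a)
  show ?case
  proof (cases "a = 0")
    case False
    then have IH: "a div 2 + b div 2 = (a div 2 XOR b div 2) + 2 * (a div 2 AND b div 2)"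
      by (intro less.IH) simp
    have x: "a XOR b = of_bool (odd a \<noteq> odd b) + 2 * (a div 2 XOR b div 2)"
      by (rule xor_rec)
    have y: "a AND b = of_bool (odd a \<and> odd b) + 2 * (a div 2 AND b div 2)"
      by (rule and_rec)
    have "a + b = of_bool (odd a) + of_bool (odd b) + 2 * (a div 2 + b div 2)"
      by (simp add: of_bool_odd_eq_mod_2)
    also have "\<dots> = (a XOR b) + 2 * (a AND b)"
      unfolding IH x y by (cases "odd a"; cases "odd b") simp_all
    finally show ?thesis .
  qed simp
qed

lemma xor_less_power:
  fixes a b :: nat
  assumes "a < 2 ^ n" "b < 2 ^ n"
  shows "a XOR b < 2 ^ n"
  using assms by (simp flip: take_bit_nat_eq_self_iff)

lemma leading_digit_add_eq_xor:
  fixes m :: nat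
  assumes "m < 2 ^ n"
  shows "2 ^ n + m = 2 ^ n XOR m"
proof (rule disjunctive_add_eq_xor, rule bit_eqI)
  fix i
  have "\<not> bit m n"
    using assms by (metis bit_take_bit_iff less_irrefl take_bit_nat_eq_self_iff)
  then show "bit (2 ^ n AND m) i \<longleftrightarrow> bit 0 i"
    by (auto simp: bit_simps)
qed

lemma dyadic_blockE:
  assumes "k \<in> dyadic_block n"
  obtains a where "a < 2 ^ n" "k = 2 ^ n XOR a"
proof
  show "k - 2 ^ n < 2 ^ n" using assms by auto
  then show "k = 2 ^ n XOR (k - 2 ^ n)"
    using assms by (simp flip: leading_digit_add_eq_xor)
qed

lemma rearrangement_block_affine:
  assumes "piecewise_linear_rearrangement \<sigma>"
  obtains \<tau> where "\<And>a b. a < 2 ^ n \<Longrightarrow> b < 2 ^ n \<Longrightarrow> \<tau> (a XOR b) = \<tau> a XOR \<tau> b"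
    and "\<And>a. a < 2 ^ n \<Longrightarrow> \<sigma> (2 ^ n XOR a) = 2 ^ n XOR \<tau> a"
proof -
  obtain \<tau> where t: "bij_betw \<tau> {..<2 ^ n} {..<2 ^ n}"
    "\<forall>a<2 ^ n. \<forall>b<2 ^ n. \<tau> (a XOR b) = \<tau> a XOR \<tau> b"
    "\<forall>m<2 ^ n. \<sigma> (2 ^ n + m) = 2 ^ n + \<tau> m"
    using assms unfolding piecewise_linear_rearrangement_def by blast
  show ?thesis
  proof
    show "\<sigma> (2 ^ n XOR a) = 2 ^ n XOR \<tau> a" if "a < 2 ^ n" for a
      using t(3) that bij_betwE[OF t(1)] by (metis leading_digit_add_eq_xor lessThan_iff)
  qed (use t in auto)
qed

lemma rearrangement_bij_block:
  assumes "piecewise_linear_rearrangement \<sigma>"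
  shows "bij_betw \<sigma> (dyadic_block n) (dyadic_block n)"
proof -
  obtain \<tau> where t: "bij_betw \<tau> {..<2 ^ n} {..<2 ^ n}"
    "\<forall>m<2 ^ n. \<sigma> (2 ^ n + m) = 2 ^ n + \<tau> m"
    using assms unfolding piecewise_linear_rearrangement_def by blast
  have inj: "inj_on \<sigma> (dyadic_block n)"
    using assms by (auto simp: piecewise_linear_rearrangement_def intro: inj_on_subset[OF bij_is_inj])
  have "\<sigma> k \<in> dyadic_block n" if "k \<in> dyadic_block n" for k
  proof -
    have "k - 2 ^ n < 2 ^ n" "k = 2 ^ n + (k - 2 ^ n)" using that by auto
    then show ?thesis
      using t bij_betwE[OF t(1)]
      by (metis atLeastLessThan_iff le_add1 lessThan_iff nat_add_left_cancel_less)
  qed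
  then have "\<sigma> ` dyadic_block n \<subseteq> dyadic_block n" by blast
  with inj show ?thesis
    by (simp add: bij_betw_def endo_inj_surj)
qed

text \<open>The leading digits of three indices combine to a single leading digit, so that an affine
  map is as good as a linear one here.\<close>

lemma rearrangement_xor3:
  assumes "piecewise_linear_rearrangement \<sigma>"
    and k: "k \<in> dyadic_block n" and l: "l \<in> dyadic_block n" and m: "m \<in> dyadic_block n"
  shows "\<sigma> (k XOR l XOR m) = \<sigma> k XOR \<sigma> l XOR \<sigma> m"
proof -
  obtain \<tau> where t: "\<And>a b. a < 2 ^ n \<Longrightarrow> b < 2 ^ n \<Longrightarrow> \<tau> (a XOR b) = \<tau> a XOR \<tau> b"
    "\<And>a. a < 2 ^ n \<Longrightarrow> \<sigma> (2 ^ n XOR a) = 2 ^ n XOR \<tau> a"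
    using rearrangement_block_affine[OF assms(1)] by metis
  obtain a b c where abc: "a < 2 ^ n" "b < 2 ^ n" "c < 2 ^ n"
    and eq: "k = 2 ^ n XOR a" "l = 2 ^ n XOR b" "m = 2 ^ n XOR c"
    using dyadic_blockE k l m by metis
  have "k XOR l XOR m = 2 ^ n XOR (a XOR b XOR c)"
    unfolding eq by (rule bit_eqI) (auto simp: bit_xor_iff)
  then have "\<sigma> (k XOR l XOR m) = 2 ^ n XOR \<tau> a XOR \<tau> b XOR \<tau> c"
    using abc t by (simp add: xor_less_power)
  also have "\<dots> = \<sigma> k XOR \<sigma> l XOR \<sigma> m"
    unfolding eq t(2)[OF abc(1)] t(2)[OF abc(2)] t(2)[OF abc(3)]
    by (rule bit_eqI) (auto simp: bit_xor_iff)
  finally show ?thesis .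
qed

section \<open>Counting the additive and dyadic quadruples\<close>

text \<open>Equal sums with equal carry-free sums have equal carries.\<close>

lemma equal_sum_and_xor_imp_equal_and:
  fixes k l m q :: nat
  assumes "k + l = m + q" "k XOR l = m XOR q"
  shows "k AND l = m AND q"
  using assms add_eq_xor_plus_double_and[of k l] add_eq_xor_plus_double_and[of m q] by simp

lemma A_tilde_xor:
  assumes "piecewise_linear_rearrangement \<sigma>" and "(k, l, m) \<in> A_tilde \<sigma> n"
  shows "k XOR l XOR m = k + l - m"
proof -
  have "\<sigma> (k XOR l XOR m) = \<sigma> (k + l - m)"
    using assms by (subst rearrangement_xor3[where n = n]) (auto simp: A_tilde_def)
  then show ?thesis
    using assms(1) by (auto simp: piecewise_linear_rearrangement_def bij_def inj_eq)
qed

text \<open>With \<open>q = k + l - m\<close>, the digits of \<open>k\<close> and \<open>l\<close> have the same exclusive or and the same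
conjunction as those of \<open>m\<close> and \<open>q\<close>. The two operations determine an unordered pair of digits,
so if \<open>k\<close> and \<open>l\<close> share a digit, \<open>m\<close> must have it as well.\<close>

lemma A_tilde_digits:
  assumes "piecewise_linear_rearrangement \<sigma>" and "(k, l, m) \<in> A_tilde \<sigma> n"
    and "bit k i \<longleftrightarrow> bit l i"
  shows "bit m i \<longleftrightarrow> bit k i"
proof -
  let ?q = "k + l - m"
  have x: "k XOR l XOR m = ?q" by (rule A_tilde_xor[OF assms(1,2)])
  have "k XOR l = m XOR (k XOR l XOR m)" by (rule bit_eqI) (auto simp: bit_xor_iff)
  then have xor: "k XOR l = m XOR ?q" by (simp only: x)
  have "k + l = m + ?q" using assms(2) by (auto simp: A_tilde_def)
  from equal_sum_and_xor_imp_equal_and[OF this xor]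
  have "bit (k AND l) i \<longleftrightarrow> bit (m AND ?q) i" by simp
  moreover have "bit (k XOR l) i \<longleftrightarrow> bit (m XOR ?q) i" using xor by simp
  ultimately show ?thesis
    using assms(3) by (auto simp: bit_xor_iff bit_and_iff)
qed

lemma dyadic_block_eqI:
  assumes "k \<in> dyadic_block n" "l \<in> dyadic_block n"
    and bits: "\<And>i. i < n \<Longrightarrow> bit k i \<longleftrightarrow> bit l i"
  shows "k = l"
proof -
  obtain a b where ab: "a < 2 ^ n" "b < 2 ^ n" and eq: "k = 2 ^ n XOR a" "l = 2 ^ n XOR b"
    using dyadic_blockE assms(1,2) by metis
  have "take_bit n a = take_bit n b"
    using bits by (intro bit_eqI) (auto simp: bit_take_bit_iff eq bit_simps)
  with ab eq show ?thesis by (simp add: take_bit_nat_eq_self)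
qed

text \<open>The leading digits are fixed, so a triple is determined by its lower \<open>n\<close> digit patterns, each
of which lies in a set of 6 elements.\<close>

lemma card_A_tilde_le:
  assumes "piecewise_linear_rearrangement \<sigma>"
  shows "card (A_tilde \<sigma> n) \<le> 6 ^ n"
proof -
  define D where "D = {(a, b, c). (a \<longleftrightarrow> b) \<longrightarrow> (c \<longleftrightarrow> a)}"
  define digits where
    "digits = (\<lambda>(k :: nat, l :: nat, m :: nat). \<lambda>i\<in>{..<n}. (bit k i, bit l i, bit m i))"
  have "D = {(True, True, True), (False, False, False), (True, False, True), (True, False, False),
      (False, True, True), (False, True, False)}"
    unfolding D_def by auto
  then have D: "card D = 6" "finite D" by simp_all
  have "inj_on digits (A_tilde \<sigma> n)"
  proof (rule inj_onI)
    fix u v assume uv: "u \<in> A_tilde \<sigma> n" "v \<in> A_tilde \<sigma> n" "digits u = digits v"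
    obtain k l m k' l' m' where u: "u = (k, l, m)" and v: "v = (k', l', m')"
      by (metis prod_cases3)
    note A = uv(1,2)[unfolded u v] and eq = uv(3)[unfolded u v]
    have "(bit k i, bit l i, bit m i) = (bit k' i, bit l' i, bit m' i)" if "i < n" for i
      using fun_cong[OF eq, of i] that by (simp add: digits_def)
    then have bits: "bit k i = bit k' i" "bit l i = bit l' i" "bit m i = bit m' i" if "i < n" for i
      using that by blast+
    show "u = v"
      unfolding u v prod.inject
    proof (intro conjI)
      show "k = k'" using A bits(1) by (intro dyadic_block_eqI[of _ n]) (auto simp: A_tilde_def)
      show "l = l'" using A bits(2) by (intro dyadic_block_eqI[of _ n]) (auto simp: A_tilde_def)
      show "m = m'" using A bits(3) by (intro dyadic_block_eqI[of _ n]) (auto simp: A_tilde_def)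
    qed
  qed
  moreover have "digits ` A_tilde \<sigma> n \<subseteq> {..<n} \<rightarrow>\<^sub>E D"
    using A_tilde_digits[OF assms] by (auto simp: digits_def D_def split: if_splits)
  ultimately have "card (A_tilde \<sigma> n) \<le> card ({..<n} \<rightarrow>\<^sub>E D)"
    using D by (intro card_inj_on_le) (auto intro: finite_PiE)
  then show ?thesis by (simp add: card_PiE D)
qed

section \<open>The Walsh-Kaczmarz rearrangement\<close>

definition reverse_digits :: "nat \<Rightarrow> nat \<Rightarrow> nat" where
  "reverse_digits k m = (\<Sum>i<k. of_bool (bit m (k - 1 - i)) * 2 ^ i)"

lemma reverse_digits_less: "reverse_digits k m < 2 ^ k"
  and bit_reverse_digits: "bit (reverse_digits k m) j \<longleftrightarrow> j < k \<and> bit m (k - 1 - j)"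
  using bit_sum_digits[where k = k and x = "\<lambda>i. bit m (k - 1 - i)"] by (auto simp: reverse_digits_def)

lemma reverse_digits_involution:
  assumes "m < 2 ^ k"
  shows "reverse_digits k (reverse_digits k m) = m"
proof -
  have "reverse_digits k (reverse_digits k m) = take_bit k m"
    by (rule bit_eqI) (auto simp: bit_reverse_digits bit_take_bit_iff)
  with assms show ?thesis by (simp add: take_bit_nat_eq_self)
qed

lemma kaczmarz_block:
  assumes "m < 2 ^ k"
  shows "kaczmarz (2 ^ k + m) = 2 ^ k + reverse_digits k m"
proof -
  have fl: "floor_log (2 ^ k + m) = k"
    using assms by (intro floor_log_eqI) auto
  have "bit (2 ^ k + m) j \<longleftrightarrow> bit m j" if "j < k" for j
    using assms that by (auto simp: leading_digit_add_eq_xor bit_simps)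
  then have "(\<Sum>i<k. of_bool (bit (2 ^ k + m) (k - 1 - i)) * 2 ^ i :: nat) = reverse_digits k m"
    unfolding reverse_digits_def by (intro sum.cong) auto
  then show ?thesis by (simp add: kaczmarz_def fl Let_def)
qed

lemma kaczmarz_involution: "kaczmarz (kaczmarz n) = n"
proof (cases "n = 0")
  case False
  define k where "k = floor_log n"
  have "2 ^ k \<le> n" "n < 2 * 2 ^ k"
    using False floor_log_exp2_le[of n] floor_log_exp2_gt[of n] by (auto simp: k_def)
  then have "n - 2 ^ k < 2 ^ k" "n = 2 ^ k + (n - 2 ^ k)" by auto
  then show ?thesis
    by (metis kaczmarz_block reverse_digits_involution reverse_digits_less)
qed (simp add: kaczmarz_def)

lemma piecewise_linear_rearrangement_kaczmarz: "piecewise_linear_rearrangement kaczmarz"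
  unfolding piecewise_linear_rearrangement_def
proof (intro conjI allI)
  show "bij kaczmarz"
    by (rule o_bij[of kaczmarz]) (auto simp: kaczmarz_involution)
  show "kaczmarz 0 = 0" by (simp add: kaczmarz_def)
  fix k
  show "\<exists>\<tau>. bij_betw \<tau> {..<2 ^ k} {..<2 ^ k} \<and>
      (\<forall>a<2 ^ k. \<forall>b<2 ^ k. \<tau> (a XOR b) = \<tau> a XOR \<tau> b) \<and>
      (\<forall>m<2 ^ k. kaczmarz (2 ^ k + m) = 2 ^ k + \<tau> m)"
  proof (intro exI conjI allI impI)
    show "bij_betw (reverse_digits k) {..<2 ^ k} {..<2 ^ k}"
      by (rule bij_betw_byWitness[of _ "reverse_digits k"])
        (auto simp: reverse_digits_involution reverse_digits_less)
    show "reverse_digits k (a XOR b) = reverse_digits k a XOR reverse_digits k b" for a b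
      by (rule bit_eqI) (auto simp: bit_reverse_digits bit_xor_iff)
  qed (simp add: kaczmarz_block)
qed

section \<open>Characters of the dyadic group\<close>

abbreviation unit_lebesgue :: "real measure" where
  "unit_lebesgue \<equiv> lebesgue_on {0..1}"

lemma bit_imp_less:
  fixes m :: nat
  assumes "bit m i" "m < 2 ^ n"
  shows "i < n"
  using assms by (metis bit_take_bit_iff take_bit_nat_eq_self_iff)

lemma bij_betw_xor:
  fixes y :: nat
  assumes "y < 2 ^ N"
  shows "bij_betw (\<lambda>x. x XOR y) {..<2 ^ N} {..<2 ^ N}"
  by (rule bij_betw_byWitness[of _ "\<lambda>x. x XOR y"])
    (auto simp: xor_less_power assms xor.assoc)

text \<open>The characters of bit strings under exclusive or; they are also the values of the Walsh
functions at points that are not dyadic rationals. In this form the symmetry between index and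
point, which the Walsh functions hide, becomes available.\<close>

definition walsh_character :: "nat \<Rightarrow> nat \<Rightarrow> complex" where
  "walsh_character x m = (\<Prod>i | bit x i. if bit m i then - 1 else 1)"

lemma walsh_character_commute: "walsh_character x m = walsh_character m x"
proof -
  have "walsh_character x m = (\<Prod>i\<in>{i \<in> {i. bit x i}. bit m i}. - 1)" for x m
    unfolding walsh_character_def by (rule prod.inter_filter[symmetric]) (rule finite_bits_nat)
  from this[of x m] this[of m x] show ?thesis
    by (simp add: conj_commute)
qed

lemma walsh_character_xor:
  "walsh_character x (a XOR b) = walsh_character x a * walsh_character x b"
  unfolding walsh_character_def prod.distrib[symmetric]
  by (intro prod.cong) (auto simp: bit_xor_iff)

lemma walsh_character_xor_left:
  "walsh_character (a XOR b) m = walsh_character a m * walsh_character b m"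
  by (simp add: walsh_character_commute[of _ m] walsh_character_xor)

lemma norm_walsh_character [simp]: "norm (walsh_character x m) = 1"
  unfolding walsh_character_def prod_norm[symmetric] by (intro prod.neutral) auto

lemma cnj_walsh_character [simp]: "cnj (walsh_character x m) = walsh_character x m"
  unfolding walsh_character_def cnj_prod by (intro prod.cong) auto

text \<open>If \<open>x\<close> has the digit \<open>j < N\<close>, then flipping the digit \<open>j\<close> of \<open>m\<close> permutes the summands and
changes the sign of each.\<close>

lemma sum_walsh_character:
  "(\<Sum>m<2 ^ N. walsh_character x m) = (if \<exists>j<N. bit x j then 0 else 2 ^ N)"
proof (cases "\<exists>j<N. bit x j")
  case True
  then obtain j where j: "j < N" "bit x j" by blast
  have "walsh_character x (2 ^ j) = - 1"
    unfolding walsh_character_commute[of x]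
    using j by (simp add: walsh_character_def bit_exp_iff)
  then have "(\<Sum>m<2 ^ N. walsh_character x (m XOR 2 ^ j)) = - (\<Sum>m<2 ^ N. walsh_character x m)"
    by (simp add: walsh_character_xor sum_negf)
  moreover have "(\<Sum>m<2 ^ N. walsh_character x (m XOR 2 ^ j)) = (\<Sum>m<2 ^ N. walsh_character x m)"
    using j by (intro sum.reindex_bij_betw bij_betw_xor) simp
  ultimately show ?thesis using True by simp
next
  case False
  then have "walsh_character x m = 1" if "m < 2 ^ N" for m
    unfolding walsh_character_def using bit_imp_less[OF _ that]
    by (intro prod.neutral) auto
  then show ?thesis using False by simp
qed

lemma walsh_character_orthogonal:
  assumes "a < 2 ^ N" "b < 2 ^ N"
  shows "(\<Sum>x<2 ^ N. walsh_character x a * walsh_character x b) = (if a = b then 2 ^ N else 0)"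
proof -
  have "(\<exists>j<N. bit (a XOR b) j) \<longleftrightarrow> a \<noteq> b"
    using bit_imp_less[OF _ assms(1)] bit_imp_less[OF _ assms(2)]
    by (auto simp: bit_xor_iff bit_eq_iff)
  then have "(\<Sum>x<2 ^ N. walsh_character x (a XOR b)) = (if a = b then 2 ^ N else 0)"
    unfolding walsh_character_commute[of _ "a XOR b"] sum_walsh_character by simp
  then show ?thesis by (simp only: walsh_character_xor)
qed

lemma AE_unit_lebesgue_not_in_countable:
  assumes "countable A"
  shows "AE t in unit_lebesgue. t \<notin> A"
proof -
  have "A \<in> null_sets lebesgue"
    using countable_imp_null_set_lborel[OF assms] by (rule null_sets_completionI)
  then have "AE t in lebesgue. t \<notin> A" by (rule AE_not_in)
  then show ?thesis by (subst AE_restrict_space_iff) auto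
qed

text \<open>Away from the dyadic rationals every Rademacher function is 1 or -1, and \<open>y\<close> collects the
positions of the negative signs.\<close>

lemma AE_walsh_eq_character:
  "AE t in unit_lebesgue. \<exists>y<2 ^ N. \<forall>m<2 ^ N. walsh m t = walsh_character y m"
proof -
  define Z :: "real set" where "Z = (\<lambda>(z :: int, i :: nat). of_int z / 2 ^ (i + 1)) ` UNIV"
  have "countable Z" unfolding Z_def by (rule countable_image) simp
  then have "AE t in unit_lebesgue. t \<notin> Z" by (rule AE_unit_lebesgue_not_in_countable)
  moreover have "\<exists>y<2 ^ N. \<forall>m<2 ^ N. walsh m t = walsh_character y m" if "t \<notin> Z" for t
  proof -
    have r: "rademacher i t = 1 \<or> rademacher i t = - 1" for i
    proof -
      have "sin (2 ^ (i + 1) * pi * t) \<noteq> 0"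
      proof
        assume "sin (2 ^ (i + 1) * pi * t) = 0"
        then obtain z :: int where "2 ^ (i + 1) * pi * t = of_int z * pi"
          using sin_zero_iff_int2 by blast
        then have "pi * (2 ^ (i + 1) * t) = pi * of_int z" by (simp only: mult_ac)
        then have "2 ^ (i + 1) * t = of_int z" by (metis mult_left_cancel pi_neq_zero)
        then have "t = of_int z / 2 ^ (i + 1)" by (simp add: field_simps)
        with that show False by (auto simp: Z_def)
      qed
      then show ?thesis by (simp add: rademacher_def sgn_if)
    qed
    define y :: nat where "y = (\<Sum>i<N. of_bool (rademacher i t = - 1) * 2 ^ i)"
    have y: "y < 2 ^ N" "bit y j \<longleftrightarrow> j < N \<and> rademacher j t = - 1" for j
      using bit_sum_digits[where k = N and x = "\<lambda>i. rademacher i t = - 1"] by (auto simp: y_def)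
    have "walsh m t = walsh_character y m" if "m < 2 ^ N" for m
    proof -
      have "complex_of_real (rademacher i t) = (if bit y i then - 1 else 1)" if "bit m i" for i
        using r[of i] y(2)[of i] bit_imp_less[OF that \<open>m < 2 ^ N\<close>] by auto
      then have "walsh m t = walsh_character m y"
        unfolding walsh_character_def walsh_def by (intro prod.cong) simp_all
      then show ?thesis by (simp only: walsh_character_commute)
    qed
    with y(1) show ?thesis by blast
  qed
  ultimately show ?thesis
    by (rule eventually_mono) simp
qed

section \<open>Moments of randomized trigonometric polynomials\<close>

lemma trig_add: "trig (k + l) t = trig k t * trig l t"
  by (simp add: trig_def exp_add[symmetric] algebra_simps)

lemma norm_trig [simp]: "norm (trig k t) = 1"
  by (simp add: trig_def norm_exp_eq_Re)

lemma continuous_on_trig [continuous_intros]: "continuous_on A (trig k)"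
  unfolding trig_def[abs_def] by (intro continuous_intros)

lemma finite_measure_unit_lebesgue: "finite_measure unit_lebesgue"
  by (rule finite_measure_lebesgue_on) simp

lemma measure_unit_lebesgue [simp]: "measure unit_lebesgue {0..1} = 1"
  by (simp add: measure_restrict_space)

lemma integrable_unit_bounded_continuous:
  fixes f :: "real \<Rightarrow> 'a :: {banach, second_countable_topology}"
  assumes "continuous_on UNIV f" and "\<And>t. norm (f t) \<le> C"
  shows "integrable unit_lebesgue f"
proof -
  have "f \<in> borel_measurable unit_lebesgue"
    using assms(1) by (intro measurable_restrict_space1 measurable_completion)
      (simp add: borel_measurable_continuous_onI)
  then show ?thesis
    using assms(2)
    by (intro finite_measure.integrable_const_bound[OF finite_measure_unit_lebesgue, of _ C]) auto
qed

lemma integral_trig_cnj_trig: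
  "(\<integral>t. trig k t * cnj (trig l t) \<partial>unit_lebesgue) = (if k = l then 1 else 0)"
proof (cases "k = l")
  case True
  have "trig k t * cnj (trig k t) = 1" for t
    by (simp flip: complex_norm_square)
  with True show ?thesis by simp
next
  case False
  define c where "c = 2 * of_real pi * \<i> * (of_nat k - of_nat l)"
  have c: "c \<noteq> 0" using False by (simp add: c_def)
  have e: "trig k t * cnj (trig l t) = exp (c * of_real t)" for t
    by (simp add: trig_def c_def exp_cnj exp_add[symmetric] algebra_simps)
  have "exp (2 * of_int (int k - int l) * of_real pi * \<i>) = 1"
    using exp_integer_2pi[of "of_int (int k - int l)"] by simp
  then have exp1: "exp c = 1" by (simp add: c_def algebra_simps)
  have "((\<lambda>t. exp (c * of_real t)) has_integral
      (exp (c * of_real 1) / c - exp (c * of_real 0) / c)) {0..1}"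
  proof (rule fundamental_theorem_of_calculus)
    fix t :: real
    have "((\<lambda>z. exp (c * z) / c) has_field_derivative exp (c * of_real t)) (at (of_real t))"
      using c by (auto intro!: derivative_eq_intros)
    then show "((\<lambda>t. exp (c * of_real t) / c) has_vector_derivative exp (c * of_real t))
        (at t within {0..1})"
      by (rule has_vector_derivative_real_field)
  qed simp
  then have "integral {0..1} (\<lambda>t. exp (c * of_real t)) = 0"
    using exp1 by (simp add: integral_unique)
  moreover have "integrable unit_lebesgue (\<lambda>t. exp (c * of_real t))"
    unfolding e[symmetric]
    by (rule integrable_unit_bounded_continuous[where C = 1])
      (auto intro!: continuous_intros simp: norm_mult)
  ultimately show ?thesis
    using False by (simp add: e lebesgue_integral_eq_integral)
qed

text \<open>Expanding the square leaves only the pairs that survive both orthogonality relations: the one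
in \<open>t\<close> forces equal frequencies and the one in \<open>x\<close> equal characters. With an arbitrary index
set the formula applies to a block as well as to its square.\<close>

lemma second_moment:
  fixes f g :: "'a \<Rightarrow> nat"
  assumes I: "finite I" and g: "\<And>i. i \<in> I \<Longrightarrow> g i < 2 ^ N"
  shows "(\<Sum>x<2 ^ N. \<integral>t. norm (\<Sum>i\<in>I. walsh_character x (g i) * trig (f i) t) ^ 2 \<partial>unit_lebesgue)
    = 2 ^ N * real (card {(i, j) \<in> I \<times> I. f i = f j \<and> g i = g j})"
proof -
  let ?\<chi> = walsh_character
  have int: "integrable unit_lebesgue (\<lambda>t. trig k t * cnj (trig l t))" for k l
    by (rule integrable_unit_bounded_continuous[where C = 1])
      (auto intro!: continuous_intros simp: norm_mult)
  have "complex_of_real (\<integral>t. norm (\<Sum>i\<in>I. ?\<chi> x (g i) * trig (f i) t) ^ 2 \<partial>unit_lebesgue)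
      = (\<Sum>i\<in>I. \<Sum>j\<in>I. ?\<chi> x (g i) * ?\<chi> x (g j) * of_bool (f i = f j))" for x
  proof -
    have "complex_of_real (norm (\<Sum>i\<in>I. ?\<chi> x (g i) * trig (f i) t) ^ 2)
        = (\<Sum>i\<in>I. \<Sum>j\<in>I. ?\<chi> x (g i) * ?\<chi> x (g j) * (trig (f i) t * cnj (trig (f j) t)))" for t
      unfolding complex_norm_square by (simp add: sum_product mult_ac)
    then have "complex_of_real (\<integral>t. norm (\<Sum>i\<in>I. ?\<chi> x (g i) * trig (f i) t) ^ 2 \<partial>unit_lebesgue)
        = (\<integral>t. (\<Sum>i\<in>I. \<Sum>j\<in>I. ?\<chi> x (g i) * ?\<chi> x (g j) * (trig (f i) t * cnj (trig (f j) t)))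
            \<partial>unit_lebesgue)"
      by (simp flip: integral_complex_of_real)
    also have "\<dots> = (\<Sum>i\<in>I. \<Sum>j\<in>I. ?\<chi> x (g i) * ?\<chi> x (g j) * of_bool (f i = f j))"
      by (simp add: int integral_trig_cnj_trig of_bool_def)
    finally show ?thesis .
  qed
  then have "complex_of_real (\<Sum>x<2 ^ N.
        \<integral>t. norm (\<Sum>i\<in>I. ?\<chi> x (g i) * trig (f i) t) ^ 2 \<partial>unit_lebesgue)
      = (\<Sum>x<2 ^ N. \<Sum>i\<in>I. \<Sum>j\<in>I. ?\<chi> x (g i) * ?\<chi> x (g j) * of_bool (f i = f j))"
    by (simp only: of_real_sum)
  also have "\<dots> = (\<Sum>i\<in>I. \<Sum>x<2 ^ N. \<Sum>j\<in>I. ?\<chi> x (g i) * ?\<chi> x (g j) * of_bool (f i = f j))"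
    by (rule sum.swap)
  also have "\<dots> = (\<Sum>i\<in>I. \<Sum>j\<in>I. \<Sum>x<2 ^ N. ?\<chi> x (g i) * ?\<chi> x (g j) * of_bool (f i = f j))"
    by (intro sum.cong refl sum.swap)
  also have "\<dots> = (\<Sum>i\<in>I. \<Sum>j\<in>I. 2 ^ N * of_bool (f i = f j \<and> g i = g j))"
    by (intro sum.cong refl)
      (auto simp: sum_distrib_right[symmetric] walsh_character_orthogonal g)
  also have "\<dots> = 2 ^ N * (\<Sum>u\<in>I \<times> I. of_bool (f (fst u) = f (snd u) \<and> g (fst u) = g (snd u)))"
    by (simp add: sum_distrib_left sum.cartesian_product case_prod_unfold)
  also have "\<dots> = 2 ^ N * of_nat (card {u \<in> I \<times> I. f (fst u) = f (snd u) \<and> g (fst u) = g (snd u)})"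
    using I by (simp add: sum_of_bool_eq Int_def)
  also have "{u \<in> I \<times> I. f (fst u) = f (snd u) \<and> g (fst u) = g (snd u)}
      = {(i, j) \<in> I \<times> I. f i = f j \<and> g i = g j}"
    by auto
  finally have "complex_of_real (\<Sum>x<2 ^ N.
        \<integral>t. norm (\<Sum>i\<in>I. ?\<chi> x (g i) * trig (f i) t) ^ 2 \<partial>unit_lebesgue)
      = complex_of_real (2 ^ N * real (card {(i, j) \<in> I \<times> I. f i = f j \<and> g i = g j}))"
    by simp
  then show ?thesis by (simp only: of_real_eq_iff)
qed

section \<open>Moments of a dyadic block\<close>

definition trig_block :: "(nat \<Rightarrow> nat) \<Rightarrow> nat \<Rightarrow> nat \<Rightarrow> real \<Rightarrow> complex" where
  "trig_block \<sigma> n x t = (\<Sum>k\<in>dyadic_block n. walsh_character x (\<sigma> k) * trig k t)"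

definition walsh_block :: "(nat \<Rightarrow> nat) \<Rightarrow> nat \<Rightarrow> nat \<Rightarrow> real \<Rightarrow> complex" where
  "walsh_block \<sigma> n x t = (\<Sum>k\<in>dyadic_block n. walsh_character x (\<sigma> k) * walsh (\<sigma> k) t)"

text \<open>The moments are summed over \<open>x\<close>, not averaged; the common factor \<open>2^(n+1)\<close> is irrelevant for
comparing them.\<close>

definition trig_moment :: "(nat \<Rightarrow> nat) \<Rightarrow> nat \<Rightarrow> real \<Rightarrow> real" where
  "trig_moment \<sigma> n p =
     (\<Sum>x<2 ^ (n + 1). \<integral>t. norm (trig_block \<sigma> n x t) powr p \<partial>unit_lebesgue)"

definition walsh_moment :: "(nat \<Rightarrow> nat) \<Rightarrow> nat \<Rightarrow> real \<Rightarrow> real" where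
  "walsh_moment \<sigma> n p =
     (\<Sum>x<2 ^ (n + 1). \<integral>t. norm (walsh_block \<sigma> n x t) powr p \<partial>unit_lebesgue)"

lemma Lp_space_ereal_integrable:
  assumes "f \<in> Lp_space (ereal p)"
  shows "integrable unit_lebesgue (\<lambda>t. norm (f t) powr p)"
  using assms by (simp add: Lp_space_def)

lemma integrable_trig_block:
  "1 \<le> p \<Longrightarrow> integrable unit_lebesgue (\<lambda>t. norm (trig_block \<sigma> n x t) powr p)"
  unfolding trig_block_def
  by (intro Lp_space_ereal_integrable trig_sum_in_Lp) (simp add: one_ereal_def)

lemma integrable_walsh_block:
  "1 \<le> p \<Longrightarrow> integrable unit_lebesgue (\<lambda>t. norm (walsh_block \<sigma> n x t) powr p)"
  unfolding walsh_block_def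
  by (intro Lp_space_ereal_integrable walsh_sum_in_Lp) (simp add: one_ereal_def)

lemma norm_trig_block_le: "norm (trig_block \<sigma> n x t) \<le> 2 ^ n"
proof -
  have "norm (trig_block \<sigma> n x t) \<le> (\<Sum>k\<in>dyadic_block n. 1)"
    unfolding trig_block_def by (intro sum_norm_le) (simp add: norm_mult)
  then show ?thesis by simp
qed

lemma rearrangement_block_less:
  assumes "piecewise_linear_rearrangement \<sigma>" "k \<in> dyadic_block n"
  shows "\<sigma> k < 2 ^ (n + 1)"
proof -
  have "\<sigma> k \<in> dyadic_block n"
    using bij_betwE[OF rearrangement_bij_block[OF assms(1)]] assms(2) by blast
  then show ?thesis by simp
qed

lemma trig_moment_2:
  assumes "piecewise_linear_rearrangement \<sigma>"
  shows "trig_moment \<sigma> n 2 = 2 * 4 ^ n"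
proof -
  have "trig_moment \<sigma> n 2
      = 2 ^ (n + 1) * real (card {(k, l) \<in> dyadic_block n \<times> dyadic_block n. k = l \<and> \<sigma> k = \<sigma> l})"
    unfolding trig_moment_def trig_block_def
    using second_moment[of "dyadic_block n" \<sigma> "n + 1" "\<lambda>k. k"] rearrangement_block_less[OF assms]
    by simp
  also have "{(k, l) \<in> dyadic_block n \<times> dyadic_block n. k = l \<and> \<sigma> k = \<sigma> l}
      = (\<lambda>k. (k, k)) ` dyadic_block n"
    by auto
  also have "card \<dots> = 2 ^ n"
    by (subst card_image) (auto intro: inj_onI)
  finally show ?thesis
    using power_mult_distrib[of "2 :: real" 2 n] by simp
qed

text \<open>The square of a block polynomial is again a randomized trigonometric polynomial, with
frequencies \<open>k + l\<close> and characters \<open>\<sigma> k \<oplus> \<sigma> l\<close>, so the fourth moment is a second moment.\<close>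

lemma trig_moment_4_le_card_A_tilde:
  assumes "piecewise_linear_rearrangement \<sigma>"
  shows "trig_moment \<sigma> n 4 \<le> 2 ^ (n + 1) * real (card (A_tilde \<sigma> n))"
proof -
  let ?B = "dyadic_block n"
  define f :: "nat \<times> nat \<Rightarrow> nat" where "f = (\<lambda>(k, l). k + l)"
  define g :: "nat \<times> nat \<Rightarrow> nat" where "g = (\<lambda>(k, l). \<sigma> k XOR \<sigma> l)"
  define Q where "Q = {(u, v) \<in> (?B \<times> ?B) \<times> (?B \<times> ?B). f u = f v \<and> g u = g v}"
  have g: "g u < 2 ^ (n + 1)" if "u \<in> ?B \<times> ?B" for u
    using that rearrangement_block_less[OF assms]
    by (cases u) (simp only: g_def mem_Sigma_iff case_prod_conv xor_less_power)
  have sq: "(trig_block \<sigma> n x t)\<^sup>2 = (\<Sum>u\<in>?B \<times> ?B. walsh_character x (g u) * trig (f u) t)" for x t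
    unfolding trig_block_def power2_eq_square sum_product sum.cartesian_product
    by (intro sum.cong) (auto simp: f_def g_def walsh_character_xor trig_add)
  have "norm (trig_block \<sigma> n x t) powr 4
      = norm (\<Sum>u\<in>?B \<times> ?B. walsh_character x (g u) * trig (f u) t) ^ 2" for x t
    by (simp flip: sq add: norm_power)
  then have "trig_moment \<sigma> n 4 = 2 ^ (n + 1) * real (card Q)"
    using second_moment[of "?B \<times> ?B" g "n + 1" f] g
    by (simp only: trig_moment_def Q_def finite_cartesian_product finite_atLeastLessThan split_beta mem_Times_iff fst_conv snd_conv)
  moreover have "card Q \<le> card (A_tilde \<sigma> n)"
  proof (rule surj_card_le[OF finite_A_tilde])
    show "Q \<subseteq> (\<lambda>(k, l, m). ((k, l), (m, k + l - m))) ` A_tilde \<sigma> n"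
    proof
      fix w assume "w \<in> Q"
      then obtain k l m q where w: "w = ((k, l), (m, q))"
        and B: "k \<in> ?B" "l \<in> ?B" "m \<in> ?B" "q \<in> ?B" and s: "k + l = m + q"
        and x: "\<sigma> k XOR \<sigma> l = \<sigma> m XOR \<sigma> q"
        by (auto simp: Q_def f_def g_def)
      have "\<sigma> k XOR \<sigma> l XOR \<sigma> m = (\<sigma> k XOR \<sigma> l) XOR \<sigma> m"
        by (simp add: xor.assoc)
      also have "\<dots> = \<sigma> q"
        unfolding x by (rule bit_eqI) (auto simp: bit_xor_iff)
      finally have "(k, l, m) \<in> A_tilde \<sigma> n"
        using B s by (auto simp: A_tilde_def)
      then show "w \<in> (\<lambda>(k, l, m). ((k, l), (m, k + l - m))) ` A_tilde \<sigma> n"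
        using s w by (auto intro!: image_eqI[of _ _ "(k, l, m)"])
    qed
  qed
  ultimately show ?thesis by simp
qed

lemma trig_moment_4_le:
  assumes "piecewise_linear_rearrangement \<sigma>"
  shows "trig_moment \<sigma> n 4 \<le> 2 * 12 ^ n"
proof -
  have "trig_moment \<sigma> n 4 \<le> 2 ^ (n + 1) * real (card (A_tilde \<sigma> n))"
    by (rule trig_moment_4_le_card_A_tilde[OF assms])
  also have "\<dots> \<le> 2 ^ (n + 1) * real (6 ^ n)"
    using card_A_tilde_le[OF assms, of n] by (intro mult_left_mono of_nat_mono) auto
  also have "\<dots> = 2 * 12 ^ n" by (simp flip: power_mult_distrib)
  finally show ?thesis .
qed

text \<open>A character sums to zero over \<open>{..<2 ^ N}\<close> unless it is trivial there. If it is trivial on the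
segment below the block, the digit \<open>n\<close> of \<open>y\<close> decides between the block sums \<open>2^n\<close> and
\<open>- (2^n)\<close>.\<close>

lemma norm_sum_walsh_character_block:
  "norm (\<Sum>m\<in>dyadic_block n. walsh_character y m) = (if \<exists>j<n. bit y j then 0 else 2 ^ n)"
proof -
  have "(\<Sum>m<2 ^ (n + 1). walsh_character y m)
      = (\<Sum>m<2 ^ n. walsh_character y m) + (\<Sum>m\<in>dyadic_block n. walsh_character y m)"
    by (subst sum.union_disjoint[symmetric]) (auto intro!: sum.cong)
  then have "(\<Sum>m\<in>dyadic_block n. walsh_character y m)
      = (if \<exists>j<n + 1. bit y j then 0 else 2 ^ (n + 1)) - (if \<exists>j<n. bit y j then 0 else 2 ^ n)"
    unfolding sum_walsh_character by (simp only: add_diff_cancel_left')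
  moreover have "(\<exists>j<n + 1. bit y j) \<longleftrightarrow> (\<exists>j<n. bit y j) \<or> bit y n"
    using less_Suc_eq by auto
  ultimately show ?thesis by (simp add: norm_power)
qed

text \<open>At almost every \<open>t\<close> the Walsh functions below \<open>2^(n+1)\<close> form a character \<open>y\<close>, so that
\<open>W x t\<close> is the block sum of the character \<open>x \<oplus> y\<close>. Summation over all \<open>x\<close> removes the
dependence on \<open>y\<close>, hence on \<open>t\<close>.\<close>

lemma walsh_moment_eq:
  assumes "piecewise_linear_rearrangement \<sigma>" and p: "1 \<le> p"
  shows "walsh_moment \<sigma> n p = 2 * (2 ^ n) powr p"
proof -
  let ?X = "{..<2 ^ (n + 1)} :: nat set"
  define V where "V y = norm (\<Sum>m\<in>dyadic_block n. walsh_character y m) powr p" for y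
  have "norm (walsh_block \<sigma> n x t) powr p = V (x XOR y)"
    if "\<forall>m<2 ^ (n + 1). walsh m t = walsh_character y m" for x y t
  proof -
    have "walsh_block \<sigma> n x t = (\<Sum>k\<in>dyadic_block n. walsh_character (x XOR y) (\<sigma> k))"
      unfolding walsh_block_def walsh_character_xor_left
      using that rearrangement_block_less[OF assms(1)] by (intro sum.cong) auto
    also have "\<dots> = (\<Sum>m\<in>dyadic_block n. walsh_character (x XOR y) m)"
      by (rule sum.reindex_bij_betw[OF rearrangement_bij_block[OF assms(1)]])
    finally show ?thesis by (simp add: V_def)
  qed
  moreover have "(\<Sum>x\<in>?X. V (x XOR y)) = (\<Sum>x\<in>?X. V x)" if "y < 2 ^ (n + 1)" for y
    by (rule sum.reindex_bij_betw[OF bij_betw_xor[OF that]])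
  ultimately have "(\<Sum>x\<in>?X. norm (walsh_block \<sigma> n x t) powr p) = (\<Sum>x\<in>?X. V x)"
    if "\<exists>y<2 ^ (n + 1). \<forall>m<2 ^ (n + 1). walsh m t = walsh_character y m" for t
    using that by (metis (no_types, lifting) sum.cong)
  then have ae: "AE t in unit_lebesgue.
      (\<Sum>x\<in>?X. norm (walsh_block \<sigma> n x t) powr p) = (\<Sum>x\<in>?X. V x)"
    by (rule eventually_mono[OF AE_walsh_eq_character])
  have "walsh_moment \<sigma> n p
      = (\<integral>t. (\<Sum>x\<in>?X. norm (walsh_block \<sigma> n x t) powr p) \<partial>unit_lebesgue)"
    unfolding walsh_moment_def
    by (rule Bochner_Integration.integral_sum[symmetric]) (rule integrable_walsh_block[OF p])
  also have "\<dots> = (\<integral>t. (\<Sum>x\<in>?X. V x) \<partial>unit_lebesgue)"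
    using ae integrable_walsh_block[OF p] by (intro integral_cong_AE borel_measurable_sum) auto
  also have "\<dots> = (\<Sum>x\<in>?X. V x)" by simp
  also have "\<dots> = (\<Sum>x\<in>{0, 2 ^ n}. V x)"
  proof (rule sum.mono_neutral_right)
    show "\<forall>y\<in>?X - {0, 2 ^ n}. V y = 0"
    proof
      fix y assume y: "y \<in> ?X - {0, 2 ^ n}"
      have "\<exists>j<n. bit y j"
      \<comment> \<open>Otherwise \<open>y\<close> is a multiple of \<open>2^n\<close> below \<open>2^(n+1)\<close>.\<close>
      proof (rule ccontr)
        assume "\<not> (\<exists>j<n. bit y j)"
        then have "take_bit n y = 0"
          by (intro bit_eqI) (auto simp: bit_take_bit_iff)
        then have "y mod 2 ^ n = 0" by (simp add: take_bit_eq_mod)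
        then obtain d where "y = 2 ^ n * d" by auto
        with y have "d \<noteq> 0" "d \<noteq> 1" "d < 2" by auto
        then show False by simp
      qed
      then show "V y = 0" by (simp add: V_def norm_sum_walsh_character_block)
    qed
  qed auto
  also have "\<dots> = 2 * (2 ^ n) powr p"
    by (simp add: V_def norm_sum_walsh_character_block bit_exp_iff)
  finally show ?thesis .
qed

section \<open>Consequences of equivalence\<close>

text \<open>Summing over any finite set that contains the support changes nothing, and it keeps the index
set independent of zero coefficients.\<close>

lemma equivalent_in_Lp_finite_sumsE:
  assumes "equivalent_in_Lp p a b"
  obtains c where "c > 0"
    and "\<And>K \<xi>. finite K \<Longrightarrow>
      Lp_norm p (\<lambda>t. \<Sum>k\<in>K. \<xi> k * a k t) \<le> c * Lp_norm p (\<lambda>t. \<Sum>k\<in>K. \<xi> k * b k t)"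
    and "\<And>K \<xi>. finite K \<Longrightarrow>
      Lp_norm p (\<lambda>t. \<Sum>k\<in>K. \<xi> k * b k t) \<le> c * Lp_norm p (\<lambda>t. \<Sum>k\<in>K. \<xi> k * a k t)"
proof -
  obtain c where c: "c > 0" and eq: "\<And>\<xi> :: nat \<Rightarrow> complex. finite {k. \<xi> k \<noteq> 0} \<Longrightarrow>
        1 / c * Lp_norm p (\<lambda>t. \<Sum>k | \<xi> k \<noteq> 0. \<xi> k * a k t)
          \<le> Lp_norm p (\<lambda>t. \<Sum>k | \<xi> k \<noteq> 0. \<xi> k * b k t) \<and>
        Lp_norm p (\<lambda>t. \<Sum>k | \<xi> k \<noteq> 0. \<xi> k * b k t)
          \<le> c * Lp_norm p (\<lambda>t. \<Sum>k | \<xi> k \<noteq> 0. \<xi> k * a k t)"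
    using assms unfolding equivalent_in_Lp_def by blast
  have K: "1 / c * Lp_norm p (\<lambda>t. \<Sum>k\<in>K. \<xi> k * a k t) \<le> Lp_norm p (\<lambda>t. \<Sum>k\<in>K. \<xi> k * b k t) \<and>
      Lp_norm p (\<lambda>t. \<Sum>k\<in>K. \<xi> k * b k t) \<le> c * Lp_norm p (\<lambda>t. \<Sum>k\<in>K. \<xi> k * a k t)"
    if fin: "finite K" for K \<xi>
  proof -
    define \<eta> where "\<eta> k = (if k \<in> K then \<xi> k else 0)" for k
    have sub: "{k. \<eta> k \<noteq> 0} \<subseteq> K" by (auto simp: \<eta>_def)
    have "(\<Sum>k | \<eta> k \<noteq> 0. \<eta> k * d k t) = (\<Sum>k\<in>K. \<xi> k * d k t)" for d :: "nat \<Rightarrow> real \<Rightarrow> complex" and t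
    proof -
      have "(\<Sum>k | \<eta> k \<noteq> 0. \<eta> k * d k t) = (\<Sum>k\<in>K. \<eta> k * d k t)"
        using fin sub by (intro sum.mono_neutral_left) auto
      also have "\<dots> = (\<Sum>k\<in>K. \<xi> k * d k t)" by (intro sum.cong) (auto simp: \<eta>_def)
      finally show ?thesis .
    qed
    then show ?thesis using eq[of \<eta>] finite_subset[OF sub fin] by simp
  qed
  show ?thesis
  proof (rule that[OF c])
    fix K :: "nat set" and \<xi> :: "nat \<Rightarrow> complex" assume "finite K"
    note le = K[OF this, of \<xi>]
    show "Lp_norm p (\<lambda>t. \<Sum>k\<in>K. \<xi> k * a k t) \<le> c * Lp_norm p (\<lambda>t. \<Sum>k\<in>K. \<xi> k * b k t)"
      using conjunct1[OF le] c by (simp add: pos_divide_le_eq mult.commute)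
    show "Lp_norm p (\<lambda>t. \<Sum>k\<in>K. \<xi> k * b k t) \<le> c * Lp_norm p (\<lambda>t. \<Sum>k\<in>K. \<xi> k * a k t)"
      by (rule conjunct2[OF le])
  qed
qed

lemma integral_powr_le_of_Lp_norm_le:
  assumes p: "0 < p"
    and le: "Lp_norm (ereal p) f \<le> c * Lp_norm (ereal p) g"
  shows "(\<integral>t. norm (f t) powr p \<partial>unit_lebesgue)
    \<le> c powr p * (\<integral>t. norm (g t) powr p \<partial>unit_lebesgue)"
proof -
  let ?I = "\<lambda>f. (\<integral>t. norm (f t) powr p \<partial>unit_lebesgue)"
  have nonneg: "?I f \<ge> 0" for f :: "real \<Rightarrow> complex"
    by (rule integral_nonneg_AE) simp
  have Lp_nonneg: "Lp_norm (ereal p) f \<ge> 0" for f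
    by (simp add: Lp_norm_def)
  have Lp: "Lp_norm (ereal p) f powr p = ?I f" for f
    using p nonneg[of f] by (simp add: Lp_norm_def powr_powr)
  have "?I f = Lp_norm (ereal p) f powr p" by (rule Lp[symmetric])
  also have "\<dots> \<le> (c * Lp_norm (ereal p) g) powr p"
    by (rule powr_mono2[OF less_imp_le[OF p] Lp_nonneg le])
  also have "\<dots> = c powr p * Lp_norm (ereal p) g powr p"
    by (rule powr_mult)
  also have "Lp_norm (ereal p) g powr p = ?I g" by (rule Lp)
  finally show ?thesis .
qed

lemma equivalent_in_Lp_momentsE:
  assumes "equivalent_in_Lp (ereal p) trig (\<lambda>k. walsh (\<sigma> k))" and p: "1 \<le> p"
  obtains C where "C > 0"
    and "\<And>n. trig_moment \<sigma> n p \<le> C * walsh_moment \<sigma> n p"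
    and "\<And>n. walsh_moment \<sigma> n p \<le> C * trig_moment \<sigma> n p"
proof -
  show ?thesis
  proof (rule equivalent_in_Lp_finite_sumsE[OF assms(1)])
    fix c :: real
    assume c: "0 < c"
      and le_trig: "\<And>K \<xi>. finite K \<Longrightarrow> Lp_norm (ereal p) (\<lambda>t. \<Sum>k\<in>K. \<xi> k * trig k t)
        \<le> c * Lp_norm (ereal p) (\<lambda>t. \<Sum>k\<in>K. \<xi> k * walsh (\<sigma> k) t)"
      and le_walsh: "\<And>K \<xi>. finite K \<Longrightarrow> Lp_norm (ereal p) (\<lambda>t. \<Sum>k\<in>K. \<xi> k * walsh (\<sigma> k) t)
        \<le> c * Lp_norm (ereal p) (\<lambda>t. \<Sum>k\<in>K. \<xi> k * trig k t)"
    have pos: "0 < p" using p by simp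
    show thesis
    proof (rule that)
      show "c powr p > 0" using c by simp
      show "trig_moment \<sigma> n p \<le> c powr p * walsh_moment \<sigma> n p" for n
        unfolding trig_moment_def walsh_moment_def sum_distrib_left trig_block_def walsh_block_def
        by (rule sum_mono, rule integral_powr_le_of_Lp_norm_le[OF pos], rule le_trig) simp
      show "walsh_moment \<sigma> n p \<le> c powr p * trig_moment \<sigma> n p" for n
        unfolding trig_moment_def walsh_moment_def sum_distrib_left trig_block_def walsh_block_def
        by (rule sum_mono, rule integral_powr_le_of_Lp_norm_le[OF pos], rule le_walsh) simp
    qed
  qed
qed

lemma power_powr_swap:
  fixes a :: real
  assumes "a > 0"
  shows "(a ^ n) powr p = (a powr p) ^ n"
  using assms by (induction n) (simp_all add: powr_mult)

lemma bounded_powers_imp_le_1: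
  fixes a :: real
  assumes "\<And>n. a ^ n \<le> C"
  shows "a \<le> 1"
proof (rule ccontr)
  assume "\<not> a \<le> 1"
  then obtain n where "C < a ^ n" using real_arch_pow[of a C] by auto
  with assms[of n] show False by simp
qed

section \<open>Finite exponents\<close>

text \<open>Pointwise inequalities between powers take the place of Hoelder's inequality. They are needed
only up to \<open>2^n\<close>, the trivial bound for the block polynomials.\<close>

lemma trig_moment_le_combination:
  assumes pointwise: "\<And>v. 0 \<le> v \<Longrightarrow> v \<le> 2 ^ n \<Longrightarrow> v powr a \<le> A * v powr b + B * v powr d"
    and "1 \<le> a" "1 \<le> b" "1 \<le> d"
  shows "trig_moment \<sigma> n a \<le> A * trig_moment \<sigma> n b + B * trig_moment \<sigma> n d"
proof -
  let ?I = "\<lambda>q x. (\<integral>t. norm (trig_block \<sigma> n x t) powr q \<partial>unit_lebesgue)"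
  note int = integrable_trig_block[OF assms(2)] integrable_trig_block[OF assms(3)]
    integrable_trig_block[OF assms(4)]
  have "?I a x \<le> A * ?I b x + B * ?I d x" for x
  proof -
    have "?I a x \<le> (\<integral>t. A * norm (trig_block \<sigma> n x t) powr b
        + B * norm (trig_block \<sigma> n x t) powr d \<partial>unit_lebesgue)"
      by (intro integral_mono Bochner_Integration.integrable_add integrable_mult_right int
          pointwise norm_ge_zero norm_trig_block_le)
    also have "\<dots> = A * ?I b x + B * ?I d x"
      by (subst Bochner_Integration.integral_add) (simp_all add: int)
    finally show ?thesis .
  qed
  then have "trig_moment \<sigma> n a \<le> (\<Sum>x<2 ^ (n + 1). A * ?I b x + B * ?I d x)"
    unfolding trig_moment_def by (rule sum_mono)
  then show ?thesis
    unfolding trig_moment_def by (simp only: sum.distrib sum_distrib_left)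
qed

text \<open>The first summand alone suffices if \<open>v \<le> \<rho>\<close> and the second alone if \<open>v \<ge> \<rho>\<close>.\<close>

lemma powr_le_interpolation:
  fixes v \<rho> :: real
  assumes v: "0 \<le> v" and \<rho>: "0 < \<rho>" and "a \<le> p" "p \<le> b"
  shows "v powr p \<le> \<rho> powr (p - a) * v powr a + \<rho> powr (p - b) * v powr b"
proof (cases "v = 0")
  case False
  with v have v: "v > 0" by simp
  have split: "v powr p = v powr (p - a) * v powr a" "v powr p = v powr (p - b) * v powr b"
    using v by (simp_all flip: powr_add)
  have nonneg: "0 \<le> \<rho> powr (p - a) * v powr a" "0 \<le> \<rho> powr (p - b) * v powr b" by simp_all
  show ?thesis
  proof (cases "v \<le> \<rho>")
    case True
    have "v powr p \<le> \<rho> powr (p - a) * v powr a"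
      unfolding split(1) using True v assms by (intro mult_right_mono powr_mono2) auto
    with nonneg show ?thesis by linarith
  next
    case False
    have "v powr p \<le> \<rho> powr (p - b) * v powr b"
      unfolding split(2) using False \<rho> assms by (intro mult_right_mono powr_mono2') auto
    with nonneg show ?thesis by linarith
  qed
qed simp

lemma powr_2_split:
  "(2 ^ n) powr p = 4 ^ n * (2 powr (p - 2)) ^ n" for p :: real
proof -
  have "(2 ^ n) powr p = (2 powr p) ^ n" by (rule power_powr_swap) simp
  also have "2 powr p = 4 * 2 powr (p - 2)" by (simp add: powr_diff)
  finally show ?thesis by (simp add: power_mult_distrib)
qed

lemma sqrt_3_power_powr:
  "(sqrt 3 ^ n) powr q = (sqrt 3 powr q) ^ n"
  by (rule power_powr_swap) simp

lemma two_over_sqrt_3_powr_gt_1: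
  assumes "0 < q"
  shows "1 < (2 / sqrt 3) powr q"
proof -
  have "sqrt 3 < 2" by (rule real_less_lsqrt) simp_all
  then show ?thesis using assms by (intro gr_one_powr) simp_all
qed

lemma sqrt_3_power_squared: "(sqrt 3 ^ n)\<^sup>2 = 3 ^ n"
proof -
  have "(sqrt 3 ^ n)\<^sup>2 = ((sqrt 3)\<^sup>2) ^ n" by (simp only: power_mult[symmetric] mult.commute)
  then show ?thesis by simp
qed

text \<open>The interpolation parameter \<open>\<rho> = 3^(n/2)\<close> is the square root of the ratio of the bounds for
the fourth and the second moment of the trigonometric block, so it balances the two summands.
For the Walsh block the corresponding ratio is \<open>4^n\<close>; the quotient \<open>2 / sqrt 3\<close> of the two
square roots is the source of the exponential growth.\<close>

lemma not_equivalent_between_2_and_4: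
  assumes \<sigma>: "piecewise_linear_rearrangement \<sigma>" and p: "2 < p" "p \<le> 4"
  shows "\<not> equivalent_in_Lp (ereal p) trig (\<lambda>k. walsh (\<sigma> k))"
proof
  assume "equivalent_in_Lp (ereal p) trig (\<lambda>k. walsh (\<sigma> k))"
  then obtain C where C: "C > 0" and le: "\<And>n. walsh_moment \<sigma> n p \<le> C * trig_moment \<sigma> n p"
    by (rule equivalent_in_Lp_momentsE) (use p in simp, rule that)
  have "((2 / sqrt 3) powr (p - 2)) ^ n \<le> 2 * C" for n
  proof -
    define \<rho> where "\<rho> = sqrt 3 ^ n"
    have \<rho>: "\<rho> > 0" "\<rho>\<^sup>2 = 3 ^ n" by (simp_all add: \<rho>_def sqrt_3_power_squared)
    have "trig_moment \<sigma> n p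
        \<le> \<rho> powr (p - 2) * trig_moment \<sigma> n 2 + \<rho> powr (p - 4) * trig_moment \<sigma> n 4"
      using p \<rho>(1) by (intro trig_moment_le_combination powr_le_interpolation) auto
    also have "\<dots> \<le> \<rho> powr (p - 2) * (2 * 4 ^ n) + \<rho> powr (p - 4) * (2 * 12 ^ n)"
      using trig_moment_2[OF \<sigma>] trig_moment_4_le[OF \<sigma>]
      by (intro add_mono mult_left_mono) auto
    also have "\<rho> powr (p - 4) * (2 * 12 ^ n) = \<rho> powr (p - 2) * (2 * 4 ^ n)"
    proof -
      have "\<rho> powr (p - 2) = \<rho> powr (p - 4 + 2)" by simp
      also have "\<dots> = \<rho> powr (p - 4) * 3 ^ n" using \<rho> by (simp only: powr_add) simp
      finally show ?thesis using power_mult_distrib[of "3 :: real" 4 n] by simp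
    qed
    finally have "trig_moment \<sigma> n p \<le> 4 * 4 ^ n * (sqrt 3 powr (p - 2)) ^ n"
      by (simp add: \<rho>_def sqrt_3_power_powr)
    then have "C * trig_moment \<sigma> n p \<le> C * (4 * 4 ^ n * (sqrt 3 powr (p - 2)) ^ n)"
      using C by simp
    moreover have "2 * (4 ^ n * (2 powr (p - 2)) ^ n) = walsh_moment \<sigma> n p"
      using p by (simp add: walsh_moment_eq[OF \<sigma>] powr_2_split)
    ultimately have "2 * (4 ^ n * (2 powr (p - 2)) ^ n) \<le> C * (4 * 4 ^ n * (sqrt 3 powr (p - 2)) ^ n)"
      using le[of n] by linarith
    then have "4 ^ n * (2 powr (p - 2)) ^ n \<le> 4 ^ n * (2 * C * (sqrt 3 powr (p - 2)) ^ n)"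
      by (simp add: mult_ac)
    then have "(2 powr (p - 2)) ^ n \<le> 2 * C * (sqrt 3 powr (p - 2)) ^ n" by simp
    then show ?thesis by (simp add: powr_divide power_divide pos_divide_le_eq)
  qed
  from bounded_powers_imp_le_1[OF this] two_over_sqrt_3_powr_gt_1[of "p - 2"] p
  show False by simp
qed

text \<open>Beyond the fourth moment there is nothing to interpolate with; the trivial bound \<open>2^n\<close> for the
block polynomial is sharp enough, since the Walsh block assumes only the values 0 and
\<open>2^n\<close> in modulus almost everywhere.\<close>

lemma not_equivalent_above_4:
  assumes \<sigma>: "piecewise_linear_rearrangement \<sigma>" and p: "4 \<le> p"
  shows "\<not> equivalent_in_Lp (ereal p) trig (\<lambda>k. walsh (\<sigma> k))"
proof
  assume "equivalent_in_Lp (ereal p) trig (\<lambda>k. walsh (\<sigma> k))"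
  then obtain C where C: "C > 0" and le: "\<And>n. walsh_moment \<sigma> n p \<le> C * trig_moment \<sigma> n p"
    by (rule equivalent_in_Lp_momentsE) (use p in simp, rule that)
  have "(4 / 3) ^ n \<le> C" for n
  proof -
    define M :: real where "M = 2 ^ n"
    have M: "M > 0" "M powr 4 = 16 ^ n"
      using power_mult[of "2 :: real" 4 n] by (simp_all add: M_def mult.commute flip: power_mult)
    have "trig_moment \<sigma> n p \<le> 0 * trig_moment \<sigma> n 2 + M powr (p - 4) * trig_moment \<sigma> n 4"
    proof (rule trig_moment_le_combination)
      fix v :: real assume v: "0 \<le> v" "v \<le> 2 ^ n"
      have "v powr p = v powr (p - 4) * v powr 4"
        by (simp flip: powr_add del: powr_numeral)
      also have "\<dots> \<le> M powr (p - 4) * v powr 4"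
        using v p by (intro mult_right_mono powr_mono2) (auto simp: M_def)
      finally show "v powr p \<le> 0 * v powr 2 + M powr (p - 4) * v powr 4" by simp
    qed (use p in auto)
    also have "\<dots> \<le> M powr (p - 4) * (2 * 12 ^ n)"
      using trig_moment_4_le[OF \<sigma>] by (simp add: mult_left_mono)
    finally have "C * trig_moment \<sigma> n p \<le> C * (M powr (p - 4) * (2 * 12 ^ n))"
      using C by simp
    moreover have "walsh_moment \<sigma> n p = 2 * (M powr (p - 4) * 16 ^ n)"
    proof -
      have "M powr p = M powr (p - 4 + 4)" by simp
      also have "\<dots> = M powr (p - 4) * 16 ^ n" by (simp only: powr_add M)
      finally show ?thesis using p by (simp add: walsh_moment_eq[OF \<sigma>] M_def)
    qed
    ultimately have "M powr (p - 4) * 16 ^ n \<le> M powr (p - 4) * (C * 12 ^ n)"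
      using le[of n] by (simp add: mult_ac)
    then have "16 ^ n \<le> C * 12 ^ n" using M(1) by simp
    then have "(16 / 12) ^ n \<le> C" by (simp only: power_divide) (simp add: pos_divide_le_eq)
    then show ?thesis by simp
  qed
  from bounded_powers_imp_le_1[OF this] show False by simp
qed

text \<open>Here the second moment is interpolated between the \<open>p\<close>-th and the fourth one, which bounds the
\<open>p\<close>-th moment of the trigonometric block from below. The factor \<open>sqrt 2\<close> in \<open>\<rho>\<close> makes the
contribution of the fourth moment at most half of the second moment, so that it can be absorbed.\<close>

lemma not_equivalent_below_2:
  assumes \<sigma>: "piecewise_linear_rearrangement \<sigma>" and p: "1 \<le> p" "p < 2"
  shows "\<not> equivalent_in_Lp (ereal p) trig (\<lambda>k. walsh (\<sigma> k))"
proof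
  assume "equivalent_in_Lp (ereal p) trig (\<lambda>k. walsh (\<sigma> k))"
  then obtain C where C: "C > 0" and le: "\<And>n. trig_moment \<sigma> n p \<le> C * walsh_moment \<sigma> n p"
    by (rule equivalent_in_Lp_momentsE) (use p in simp, rule that)
  define q where "q = 2 - p"
  have q: "q > 0" using p by (simp add: q_def)
  have "((2 / sqrt 3) powr q) ^ n \<le> 2 * C * sqrt 2 powr q" for n
  proof -
    define \<rho> where "\<rho> = sqrt 2 * sqrt 3 ^ n"
    have \<rho>: "\<rho> > 0" "\<rho>\<^sup>2 = 2 * 3 ^ n"
      by (simp_all add: \<rho>_def sqrt_3_power_squared power_mult_distrib)
    have "\<rho> powr (2 - 4) * (2 * 12 ^ n) = 4 ^ n"
    proof -
      have "\<rho> powr (2 - 4) = 1 / \<rho>\<^sup>2"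
        using \<rho>(1) powr_minus_divide[of \<rho> 2] by simp
      then show ?thesis
        using \<rho> power_mult_distrib[of "3 :: real" 4 n] by simp
    qed
    moreover have "trig_moment \<sigma> n 2
        \<le> \<rho> powr (2 - p) * trig_moment \<sigma> n p + \<rho> powr (2 - 4) * trig_moment \<sigma> n 4"
      using p \<rho>(1) by (intro trig_moment_le_combination powr_le_interpolation) auto
    moreover have "\<rho> powr (2 - 4) * trig_moment \<sigma> n 4 \<le> \<rho> powr (2 - 4) * (2 * 12 ^ n)"
      by (intro mult_left_mono trig_moment_4_le[OF \<sigma>]) simp
    moreover have "trig_moment \<sigma> n 2 = 2 * 4 ^ n" by (rule trig_moment_2[OF \<sigma>])
    ultimately have "4 ^ n \<le> \<rho> powr q * trig_moment \<sigma> n p"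
      unfolding q_def by linarith
    also have "\<dots> \<le> \<rho> powr q * (C * walsh_moment \<sigma> n p)"
      using le by (intro mult_left_mono) auto
    also have "walsh_moment \<sigma> n p = 2 * (4 ^ n * (2 powr (- q)) ^ n)"
      using p by (simp add: walsh_moment_eq[OF \<sigma>] powr_2_split q_def)
    also have "\<rho> powr q = sqrt 2 powr q * (sqrt 3 powr q) ^ n"
      by (simp only: \<rho>_def powr_mult sqrt_3_power_powr)
    finally have "4 ^ n * 1
        \<le> 4 ^ n * (2 * C * sqrt 2 powr q * (sqrt 3 powr q) ^ n * (2 powr (- q)) ^ n)"
      by (simp only: mult_ac mult_1_right)
    then have "1 \<le> 2 * C * sqrt 2 powr q * (sqrt 3 powr q) ^ n * (2 powr (- q)) ^ n"
      by (simp only: mult_le_cancel_left_pos zero_less_power zero_less_numeral)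
    then have "1 \<le> 2 * C * sqrt 2 powr q * (sqrt 3 powr q) ^ n / (2 powr q) ^ n"
      by (simp add: powr_minus_divide power_divide)
    then have "(2 powr q) ^ n \<le> 2 * C * sqrt 2 powr q * (sqrt 3 powr q) ^ n"
      by (simp add: le_divide_eq)
    then show ?thesis
      by (simp add: powr_divide power_divide pos_divide_le_eq)
  qed
  from bounded_powers_imp_le_1[OF this] two_over_sqrt_3_powr_gt_1[OF q]
  show False by simp
qed

section \<open>The exponent infinity\<close>

lemma AE_norm_le_Lp_norm_infinity:
  assumes "f \<in> Lp_space \<infinity>"
  shows "AE t in unit_lebesgue. norm (f t) \<le> Lp_norm \<infinity> f"
proof -
  let ?s = "esssup unit_lebesgue (\<lambda>t. ereal (norm (f t)))"
  have fin: "?s < \<infinity>" using assms by (simp add: Lp_space_def)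
  have "norm (f t) \<le> Lp_norm \<infinity> f" if "ereal (norm (f t)) \<le> ?s" for t
    using that fin by (cases ?s) (simp_all add: Lp_norm_def)
  then show ?thesis
    by (rule eventually_mono[OF esssup_AE])
qed

lemma Lp_norm_infinity_le:
  assumes "f \<in> Lp_space \<infinity>" and "AE t in unit_lebesgue. norm (f t) \<le> M" and "0 \<le> M"
  shows "Lp_norm \<infinity> f \<le> M"
proof -
  let ?s = "esssup unit_lebesgue (\<lambda>t. ereal (norm (f t)))"
  have [measurable]: "f \<in> borel_measurable unit_lebesgue"
    using assms(1) by (simp add: Lp_space_def)
  have "?s \<le> ereal M"
    using assms(2) by (intro esssup_I) simp_all
  then show ?thesis
    using assms(3) by (cases ?s) (simp_all add: Lp_norm_def)
qed

lemma AE_bound_imp_bound: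
  fixes f :: "real \<Rightarrow> complex"
  assumes f: "continuous_on UNIV f" and ae: "AE t in unit_lebesgue. norm (f t) \<le> M"
    and u: "u \<in> {0<..<1}"
  shows "norm (f u) \<le> M"
proof (rule ccontr)
  assume "\<not> norm (f u) \<le> M"
  define U where "U = {0<..<1} \<inter> {t. M < norm (f t)}"
  have "open {t. M < norm (f t)}"
    by (rule open_Collect_less) (intro continuous_intros f)+
  then have "open U" unfolding U_def by (intro open_Int) simp_all
  moreover have "u \<in> U" using u \<open>\<not> norm (f u) \<le> M\<close> by (simp add: U_def)
  ultimately obtain e where e: "e > 0" "{u - e<..<u + e} \<subseteq> U"
    by (metis openE ball_eq_greaterThanLessThan)
  have "AE t in lebesgue. t \<in> {0..1} \<longrightarrow> norm (f t) \<le> M"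
    using ae by (subst (asm) AE_restrict_space_iff) auto
  then have "AE t in lebesgue. t \<notin> U"
    by (rule eventually_mono) (auto simp: U_def)
  moreover have "U \<in> sets lebesgue" using \<open>open U\<close> by (simp add: borel_open)
  ultimately have "negligible U"
    by (simp add: negligible_iff_null_sets AE_iff_null_sets)
  then have "negligible {u - e<..<u + e}" using e(2) by (rule negligible_subset)
  then show False using e(1) negligible_interval(2)[of "u - e" "u + e"] by (simp add: box_real)
qed

text \<open>The coefficients \<open>e_k(-u)\<close> align all terms of the trigonometric polynomial at \<open>u\<close>. The Walsh
polynomial with these coefficients takes, almost everywhere, only the values
\<open>cnj (trig_block \<sigma> n x u)\<close>, so its norm is at most the largest of their moduli, and the fourth
power of a maximum is at most the sum of the fourth powers.\<close>

lemma equivalent_in_Linfinity_pointwise: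
  assumes \<sigma>: "piecewise_linear_rearrangement \<sigma>"
    and c: "c > 0"
    and le: "\<And>\<xi>. Lp_norm \<infinity> (\<lambda>t. \<Sum>k\<in>dyadic_block n. \<xi> k * trig k t)
      \<le> c * Lp_norm \<infinity> (\<lambda>t. \<Sum>k\<in>dyadic_block n. \<xi> k * walsh (\<sigma> k) t)"
    and u: "u \<in> {0<..<1}"
  shows "16 ^ n \<le> c ^ 4 * (\<Sum>x<2 ^ (n + 1). norm (trig_block \<sigma> n x u) powr 4)"
proof -
  let ?X = "{..<2 ^ (n + 1)} :: nat set" and ?B = "dyadic_block n"
  define \<xi> where "\<xi> k = cnj (trig k u)" for k
  define f where "f = (\<lambda>t. \<Sum>k\<in>?B. \<xi> k * trig k t)"
  define g where "g = (\<lambda>t. \<Sum>k\<in>?B. \<xi> k * walsh (\<sigma> k) t)"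
  define M where "M = Max ((\<lambda>x. norm (trig_block \<sigma> n x u)) ` ?X)"
  have "?X \<noteq> {}" by (simp add: lessThan_empty_iff)
  then have "M \<in> (\<lambda>x. norm (trig_block \<sigma> n x u)) ` ?X"
    unfolding M_def by (intro Max_in) auto
  then obtain y where y: "y \<in> ?X" and M: "M = norm (trig_block \<sigma> n y u)" by blast
  have fL: "f \<in> Lp_space \<infinity>" unfolding f_def by (rule trig_sum_in_Lp) simp
  have gL: "g \<in> Lp_space \<infinity>" unfolding g_def by (rule walsh_sum_in_Lp) simp
  have "f u = (\<Sum>k\<in>?B. 1)"
    unfolding f_def \<xi>_def
    by (intro sum.cong refl) (simp add: mult.commute flip: complex_norm_square)
  then have "2 ^ n = norm (f u)" by (simp add: norm_power)
  also have "\<dots> \<le> Lp_norm \<infinity> f"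
    by (rule AE_bound_imp_bound[OF _ AE_norm_le_Lp_norm_infinity[OF fL] u])
      (auto simp: f_def intro!: continuous_intros)
  also have "\<dots> \<le> c * Lp_norm \<infinity> g" unfolding f_def g_def by (rule le)
  also have "\<dots> \<le> c * M"
  proof (intro mult_left_mono Lp_norm_infinity_le gL)
    have "norm (g t) \<le> M"
      if ex: "\<exists>x<2 ^ (n + 1). \<forall>m<2 ^ (n + 1). walsh m t = walsh_character x m" for t
    proof -
      obtain x where x: "x < 2 ^ (n + 1)"
        and w: "\<And>m. m < 2 ^ (n + 1) \<Longrightarrow> walsh m t = walsh_character x m"
        using ex by blast
      have "g t = cnj (trig_block \<sigma> n x u)"
        unfolding g_def trig_block_def \<xi>_def cnj_sum
        using w rearrangement_block_less[OF \<sigma>] by (intro sum.cong refl) simp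
      then have "norm (g t) = norm (trig_block \<sigma> n x u)" by simp
      also have "\<dots> \<le> M" unfolding M_def using x by (intro Max_ge) auto
      finally show ?thesis .
    qed
    then show "AE t in unit_lebesgue. norm (g t) \<le> M"
      by (rule eventually_mono[OF AE_walsh_eq_character])
  qed (use c M in auto)
  finally have "(2 ^ n) ^ 4 \<le> (c * M) ^ 4" by (rule power_mono) simp
  moreover have "(2 ^ n) ^ 4 = ((2 :: real) ^ 4) ^ n"
    by (simp only: power_mult[symmetric] mult.commute)
  ultimately have "16 ^ n \<le> c ^ 4 * M ^ 4"
    by (simp add: power_mult_distrib)
  also have "M ^ 4 \<le> (\<Sum>x\<in>?X. norm (trig_block \<sigma> n x u) powr 4)"
    using member_le_sum[of y ?X "\<lambda>x. norm (trig_block \<sigma> n x u) powr 4"] y by (simp add: M)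
  finally show ?thesis using c by simp
qed

lemma not_equivalent_in_Linfinity:
  assumes \<sigma>: "piecewise_linear_rearrangement \<sigma>"
  shows "\<not> equivalent_in_Lp \<infinity> trig (\<lambda>k. walsh (\<sigma> k))"
proof
  assume "equivalent_in_Lp \<infinity> trig (\<lambda>k. walsh (\<sigma> k))"
  then obtain c where c: "c > 0" and le: "\<And>n \<xi>.
      Lp_norm \<infinity> (\<lambda>t. \<Sum>k\<in>dyadic_block n. \<xi> k * trig k t)
      \<le> c * Lp_norm \<infinity> (\<lambda>t. \<Sum>k\<in>dyadic_block n. \<xi> k * walsh (\<sigma> k) t)"
    by (rule equivalent_in_Lp_finite_sumsE) (meson finite_atLeastLessThan)
  have "(4 / 3) ^ n \<le> 2 * c ^ 4" for n
  proof -
    let ?S = "\<lambda>t. \<Sum>x<2 ^ (n + 1). norm (trig_block \<sigma> n x t) powr 4"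
    have int: "integrable unit_lebesgue (\<lambda>t. norm (trig_block \<sigma> n x t) powr 4)" for x
      by (rule integrable_trig_block) simp
    have "AE t in unit_lebesgue. t \<notin> {0, 1}"
      by (rule AE_unit_lebesgue_not_in_countable) simp
    then have ae: "AE t in unit_lebesgue. 16 ^ n \<le> c ^ 4 * ?S t"
    proof (rule AE_mp, intro AE_I2 impI)
      fix t :: real assume "t \<in> space unit_lebesgue" "t \<notin> {0, 1}"
      then have "t \<in> {0<..<1}" by auto
      then show "16 ^ n \<le> c ^ 4 * ?S t"
        by (rule equivalent_in_Linfinity_pointwise[OF \<sigma> c le])
    qed
    have "(16 :: real) ^ n = (\<integral>t. 16 ^ n \<partial>unit_lebesgue)" by simp
    also have "\<dots> \<le> (\<integral>t. c ^ 4 * ?S t \<partial>unit_lebesgue)"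
      by (rule integral_mono_AE[OF _ _ ae])
        (intro finite_measure.integrable_const finite_measure_unit_lebesgue
          integrable_mult_right Bochner_Integration.integrable_sum int)+
    also have "\<dots> = c ^ 4 * trig_moment \<sigma> n 4"
      unfolding trig_moment_def
      by (simp only: integral_mult_right_zero) (subst Bochner_Integration.integral_sum[OF int], simp)
    also have "\<dots> \<le> c ^ 4 * (2 * 12 ^ n)"
      using c by (intro mult_left_mono trig_moment_4_le[OF \<sigma>]) simp
    finally have "(16 / 12) ^ n \<le> 2 * c ^ 4"
      by (simp only: power_divide) (simp add: pos_divide_le_eq mult_ac)
    then show ?thesis by simp
  qed
  from bounded_powers_imp_le_1[OF this] show False by simp
qed

section \<open>Non-equivalence of the systems\<close>

lemma not_equivalent_in_Lp:
  assumes \<sigma>: "piecewise_linear_rearrangement \<sigma>" and p: "1 \<le> p" "p \<noteq> 2"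
  shows "\<not> equivalent_in_Lp p trig (\<lambda>k. walsh (\<sigma> k))"
proof (cases p)
  case (real r)
  with p have "1 \<le> r" "r \<noteq> 2" by (auto simp: one_ereal_def numeral_eq_ereal)
  then consider "r < 2" | "2 < r" "r \<le> 4" | "4 \<le> r" by linarith
  then show ?thesis
    unfolding real
    using \<open>1 \<le> r\<close> not_equivalent_below_2[OF \<sigma>] not_equivalent_between_2_and_4[OF \<sigma>]
      not_equivalent_above_4[OF \<sigma>] by cases blast+
next
  case PInf
  then show ?thesis using not_equivalent_in_Linfinity[OF \<sigma>] by simp
next
  case MInf
  then show ?thesis using p by simp
qed

theorem theorem5p8:
  shows "(\<forall>\<sigma>. piecewise_linear_rearrangement \<sigma> \<longrightarrow>
            (\<forall>n. card (A_tilde \<sigma> n) \<le> 6 ^ n) \<and>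
            (\<forall>p :: ereal. 1 \<le> p \<and> p \<noteq> 2 \<longrightarrow>
               \<not> equivalent_in_Lp p trig (\<lambda>k. walsh (\<sigma> k)))) \<and>
         (\<forall>p :: ereal. 1 \<le> p \<and> p \<noteq> 2 \<longrightarrow>
            \<not> equivalent_in_Lp p trig (\<lambda>k. walsh (kaczmarz k)))"
  using card_A_tilde_le not_equivalent_in_Lp piecewise_linear_rearrangement_kaczmarz by blast

end
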